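(* For each integer $n\ge 0$ let $\rho(n)$ denote the number of partitions of $n$ of type $\Lambda$, i.e. partitions of $n$ in which the largest part $\ell$ appears exactly once and the remaining parts (all strictly smaller than $\ell$) form a partition of $\ell$. Then, as formal power series in $q$ (or for $|q|<1$), $$\sum_{n=0}^{\infty}\rho(n)q^n=\frac{1}{(q^2;q^2)_{\infty}}-\frac{1}{1-q^2}.$$
   Context: A partition of a positive integer $n$ is a way of writing $n$ as a sum of positive integers (parts), listed in non-increasing order; the empty partition is the only partition of $0$ and has no largest part, so it is not of type $\Lambda$. For $|q|<1$, $(t;q)_0=1$, $(t;q)_n=(1-t)(1-tq)\cdots(1-tq^{n-1})$ for $n>0$, and $(t;q)_\infty=\lim_{n\to\infty}(t;q)_n$. *)

theory Defs
  imports "HOL-Analysis.Analysis" "HOL-Computational_Algebra.Formal_Power_Series"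
begin

definition partition_of :: "nat \<Rightarrow> nat list \<Rightarrow> bool" where
  "partition_of n xs \<longleftrightarrow> sorted_wrt (\<ge>) xs \<and> 0 \<notin> set xs \<and> sum_list xs = n"

definition type_Lambda :: "nat list \<Rightarrow> bool" where
  "type_Lambda xs \<longleftrightarrow> xs \<noteq> [] \<and>
     (let l = Max (set xs) in count_list xs l = 1 \<and> partition_of l (remove1 l xs))"

definition rho :: "nat \<Rightarrow> nat" where
  "rho n = card {xs. partition_of n xs \<and> type_Lambda xs}"

text \<open>The set counted by \<open>rho\<close> is finite, so \<open>card\<close> is a true count.\<close>

lemma finite_partitions: "finite {xs. partition_of n xs}"
proof (rule finite_subset)
  have "length xs \<le> sum_list xs" if "0 \<notin> set xs" for xs :: "nat list"
    using that by (induction xs) (auto simp: Suc_le_eq)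
  then show "{xs. partition_of n xs} \<subseteq> {xs. set xs \<subseteq> {..n} \<and> length xs \<le> n}"
    by (auto simp: partition_of_def member_le_sum_list)
  show "finite {xs. set xs \<subseteq> {..n} \<and> length xs \<le> n}"
    by (rule finite_lists_length_le) simp
qed

definition qpoch :: "'a::comm_ring_1 \<Rightarrow> 'a \<Rightarrow> nat \<Rightarrow> 'a" where
  "qpoch t q n = (\<Prod>k<n. 1 - t * q ^ k)"

text \<open>
  On complex numbers the limit is the usual one (it exists for \<open>norm q < 1\<close>); on formal
  power series it is taken in the metric of \<open>Formal_Power_Series\<close>, that is, coefficientwise
  with eventually constant coefficients.
\<close>

definition qpoch_inf :: "'a::{comm_ring_1, t2_space} \<Rightarrow> 'a \<Rightarrow> 'a" where
  "qpoch_inf t q = lim (\<lambda>n. qpoch t q n)"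

end

theory Submission
  imports Defs "HOL-Computational_Algebra.Formal_Laurent_Series"
begin

text \<open>
  Removing the largest part of a partition of type \<open>\<Lambda>\<close> with largest part \<open>m\<close> leaves a partition of
  \<open>m\<close> other than \<open>[m]\<close>, and every such partition arises. Hence \<open>rho (2 * m) = p(m) - 1\<close> and \<open>rho\<close>
  vanishes at odd numbers, so it remains to prove Euler's formula for the generating function of
  \<open>p\<close>. The generating function of the partitions with parts at most \<open>k\<close> is the reciprocal of
  \<open>qpoch q q k\<close>, by recursion on whether \<open>k\<close> occurs as a part. Letting \<open>k\<close> tend to infinity is
  trivial for formal power series; in the complex plane it is dominated convergence, with the
  majorant supplied by the case of real nonnegative \<open>q\<close>.
\<close>

section \<open>Partitions with bounded parts and their recursion\<close>

definition parts_le :: "nat \<Rightarrow> nat \<Rightarrow> nat list set" where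
  "parts_le k n = {xs. partition_of n xs \<and> set xs \<subseteq> {..k}}"

lemma finite_parts_le: "finite (parts_le k n)"
  by (rule finite_subset[OF _ finite_partitions[of n]]) (auto simp: parts_le_def)

lemma partition_of_Cons:
  "partition_of n (y # ys) \<longleftrightarrow> 0 < y \<and> y \<le> n \<and> set ys \<subseteq> {..y} \<and> partition_of (n - y) ys"
  by (auto simp: partition_of_def)

lemma parts_le_eq_partitions: "n \<le> k \<Longrightarrow> parts_le k n = {xs. partition_of n xs}"
  by (auto simp: parts_le_def partition_of_def dest: member_le_sum_list)

lemma parts_le_0: "parts_le 0 n = (if n = 0 then {[]} else {})"
proof -
  have "partition_of n xs \<and> set xs \<subseteq> {..0} \<longleftrightarrow> n = 0 \<and> xs = []" for xs
    by (cases xs) (auto simp: partition_of_def)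
  then show ?thesis
    by (auto simp: parts_le_def)
qed

text \<open>Non-increasing order puts \<open>Suc k\<close> first whenever it occurs. It may occur
  again, so the tail keeps the bound \<open>Suc k\<close> and only the sum drops.\<close>

lemma parts_le_Suc:
  "parts_le (Suc k) n =
     parts_le k n \<union> (if Suc k \<le> n then Cons (Suc k) ` parts_le (Suc k) (n - Suc k) else {})"
  (is "?L = ?R")
proof (intro equalityI subsetI)
  fix xs assume xs: "xs \<in> ?L"
  show "xs \<in> ?R"
  proof (cases "set xs \<subseteq> {..k}")
    case True
    then show ?thesis using xs by (auto simp: parts_le_def)
  next
    case False
    with xs have "Suc k \<in> set xs"
      by (auto simp: parts_le_def subset_iff not_le) (metis le_antisym Suc_leI)
    then obtain y ys where eq: "xs = y # ys" by (cases xs) auto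
    with xs \<open>Suc k \<in> set xs\<close> have "y = Suc k"
      by (fastforce simp: parts_le_def partition_of_Cons)
    with xs eq show ?thesis
      by (auto simp: parts_le_def partition_of_Cons)
  qed
next
  fix xs assume "xs \<in> ?R"
  then show "xs \<in> ?L"
    by (auto simp: parts_le_def partition_of_Cons split: if_splits)
qed

lemma card_parts_le_Suc:
  "card (parts_le (Suc k) n) =
     card (parts_le k n) + (if Suc k \<le> n then card (parts_le (Suc k) (n - Suc k)) else 0)"
proof -
  have "parts_le k n \<inter> Cons (Suc k) ` parts_le (Suc k) (n - Suc k) = {}"
    by (auto simp: parts_le_def)
  then show ?thesis
    by (subst parts_le_Suc) (simp add: card_Un_disjoint finite_parts_le card_image)
qed

text \<open>The form of the recursion shared by the real partial sums and the complex series
  below.\<close>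

lemma weighted_parts_le_Suc:
  fixes x :: "'a::comm_semiring_1"
  shows "of_nat (card (parts_le (Suc k) n)) * x ^ n =
    of_nat (card (parts_le k n)) * x ^ n +
    (if Suc k \<le> n then x ^ Suc k * (of_nat (card (parts_le (Suc k) (n - Suc k))) * x ^ (n - Suc k)) else 0)"
proof (cases "Suc k \<le> n")
  case True
  then have "x ^ n = x ^ Suc k * x ^ (n - Suc k)"
    by (simp only: power_add [symmetric] le_add_diff_inverse)
  with True show ?thesis
    by (subst card_parts_le_Suc) (simp add: distrib_left distrib_right mult_ac)
qed (simp add: card_parts_le_Suc)

section \<open>Counting partitions of type Lambda\<close>

lemma rho_odd: "odd n \<Longrightarrow> rho n = 0"
  and rho_even: "rho (2 * m) = card {xs. partition_of m xs} - 1"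
proof -
  \<comment> \<open>The head is the largest part and the rest sums to it, so
    \<open>n = 2 * y\<close>. That \<open>y\<close> does not recur becomes
    \<open>ys \<noteq> [y]\<close>, because a part equal to the whole sum leaves no room for
    others.\<close>
  have Lambda_iff: "partition_of n xs \<and> type_Lambda xs \<longleftrightarrow>
      (\<exists>y ys. xs = y # ys \<and> n = 2 * y \<and> 0 < y \<and> partition_of y ys \<and> ys \<noteq> [y])" for n xs
  proof (cases xs)
    case Nil
    then show ?thesis by (simp add: type_Lambda_def)
  next
    case (Cons y ys)
    have Max: "Max (set (y # ys)) = y" if "set ys \<subseteq> {..y}"
      using that by (intro Max_eqI) auto
    have singleton: "ys = [y]" if "partition_of y ys" "y \<in> set ys" "0 < y"
    proof -
      obtain z zs where zs: "ys = z # zs" using \<open>y \<in> set ys\<close> by (cases ys) auto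
      with that have "z = y"
        by (fastforce simp: partition_of_Cons)
      with that zs show ?thesis
        by (cases zs) (auto simp: partition_of_def)
    qed
    have bound: "set ys \<subseteq> {..y}" if "partition_of y ys"
      using that by (auto simp: partition_of_def dest: member_le_sum_list)
    have sum: "n - y = y" if "partition_of y ys" "partition_of (n - y) ys"
      using that by (auto simp: partition_of_def)
    have lhs: "partition_of n xs \<and> type_Lambda xs \<longleftrightarrow>
        0 < y \<and> y \<le> n \<and> set ys \<subseteq> {..y} \<and> partition_of (n - y) ys \<and> y \<notin> set ys \<and> partition_of y ys"
      using Cons Max by (auto simp: type_Lambda_def partition_of_Cons count_list_0_iff Let_def)
    show ?thesis
      unfolding lhs using Cons singleton bound sum by auto
  qed
  show "rho n = 0" if "odd n"
  proof -
    from that have "{xs. partition_of n xs \<and> type_Lambda xs} = {}"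
      unfolding Lambda_iff by auto
    then show ?thesis unfolding rho_def by (simp only: card.empty)
  qed
  show "rho (2 * m) = card {xs. partition_of m xs} - 1"
  \<comment> \<open>The partition discounted by the subtraction is the empty one for
    \<open>m = 0\<close> and \<open>[m]\<close> otherwise.\<close>
  proof (cases "m = 0")
    case True
    then have "{xs. partition_of (2 * m) xs \<and> type_Lambda xs} = {}"
      unfolding Lambda_iff by auto
    moreover have "{xs. partition_of m xs} = {[]}"
      using True parts_le_eq_partitions[of 0 0] by (simp add: parts_le_0)
    ultimately show ?thesis unfolding rho_def by (simp only: card.empty) simp
  next
    case False
    then have "{xs. partition_of (2 * m) xs \<and> type_Lambda xs} =
        Cons m ` ({xs. partition_of m xs} - {[m]})"
      unfolding Lambda_iff by auto
    moreover have "partition_of m [m]"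
      using False by (simp add: partition_of_def)
    ultimately show ?thesis
      by (simp add: rho_def card_image card_Diff_singleton)
  qed
qed

text \<open>Keeps the subtraction in \<open>rho_even\<close> from truncating; the case
  \<open>n = 0\<close> also supplies an invertible constant coefficient.\<close>

lemma card_partitions_pos: "0 < card {xs. partition_of n xs}"
proof -
  have "partition_of n (if n = 0 then [] else [n])"
    by (simp add: partition_of_def)
  then show ?thesis
    by (auto simp: card_gt_0_iff finite_partitions)
qed

section \<open>Euler's formula for formal power series\<close>

lemma qpoch_0 [simp]: "qpoch t q 0 = 1"
  by (simp add: qpoch_def)

lemma qpoch_self_Suc: "qpoch q q (Suc k) = qpoch q q k * (1 - q ^ Suc k)"
  by (simp add: qpoch_def)

lemma fps_parts_le:
  "Abs_fps (\<lambda>n. of_nat (card (parts_le k n))) * qpoch fps_X fps_X k = (1 :: 'a::comm_ring_1 fps)"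
proof (induction k)
  case 0
  show ?case
    by (simp add: parts_le_0 fps_eq_iff)
next
  case (Suc k)
  let ?P = "\<lambda>k. Abs_fps (\<lambda>n. of_nat (card (parts_le k n))) :: 'a fps"
  have "?P (Suc k) = ?P k + ?P (Suc k) * fps_X ^ Suc k"
    by (rule fps_ext) (simp add: card_parts_le_Suc[of k] fps_X_power_mult_right_nth not_le del: power_Suc)
  then have "?P (Suc k) * (1 - fps_X ^ Suc k) = ?P k"
    by (simp add: algebra_simps del: power_Suc)
  with Suc show ?case
    by (simp only: qpoch_self_Suc mult.assoc [symmetric]) (simp only: mult_ac)
qed

text \<open>Substituting \<open>fps_X ^ d\<close> for \<open>fps_X\<close> spreads the coefficients
  over the multiples of \<open>d\<close>, whence the divisibility test.\<close>

lemma fps_partitions: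
  fixes d :: nat
  assumes "d > 0"
  shows "(1 / qpoch_inf (fps_X ^ d) (fps_X ^ d) :: 'a::field_char_0 fps) =
    Abs_fps (\<lambda>n. if d dvd n then of_nat (card {xs. partition_of (n div d) xs}) else 0)"
    (is "_ = ?P")
proof -
  let ?A = "\<lambda>k. Abs_fps (\<lambda>n. of_nat (card (parts_le k n))) oo fps_X ^ d :: 'a fps"
  have d0: "fps_nth (fps_X ^ d :: 'a fps) 0 = 0"
    using assms by simp
  have qpoch_compose: "qpoch (fps_X ^ d) (fps_X ^ d) k = (qpoch fps_X fps_X k oo fps_X ^ d :: 'a fps)" for k
    using assms by (induction k)
      (simp_all add: qpoch_self_Suc fps_compose_mult_distrib fps_compose_sub_distrib
        fps_compose_power [symmetric] del: power_Suc)
  have "?A k * qpoch (fps_X ^ d) (fps_X ^ d) k = 1" for k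
    unfolding qpoch_compose fps_compose_mult_distrib[OF d0, symmetric] fps_parts_le by simp
  then have inv: "qpoch (fps_X ^ d) (fps_X ^ d) k = inverse (?A k)" for k
    by (metis fps_inverse_unique)
  \<comment> \<open>Coefficient \<open>n\<close> is constant from \<open>k = n\<close> on, since no
    part of a partition of \<open>n div d\<close> exceeds \<open>n\<close>.\<close>
  have "?A \<longlonglongrightarrow> ?P"
  proof (rule tendsto_fpsI)
    fix n
    show "\<forall>\<^sub>F k in sequentially. ?A k $ n = ?P $ n"
      using eventually_ge_at_top[of n]
    proof eventually_elim
      case (elim k)
      then have "n div d \<le> k" by (meson div_le_dividend le_trans)
      then show ?case
        by (simp add: fps_nth_compose_X_power parts_le_eq_partitions)
    qed
  qed
  moreover have P0: "?P $ 0 \<noteq> 0"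
    using card_partitions_pos[of 0] by simp
  ultimately have "(\<lambda>k. inverse (?A k)) \<longlonglongrightarrow> inverse ?P"
    by (rule tendsto_inverse_fps)
  then have "qpoch_inf (fps_X ^ d) (fps_X ^ d) = inverse ?P"
    unfolding qpoch_inf_def inv by (rule limI)
  with P0 show ?thesis
    by (simp add: fps_divide_unit)
qed

section \<open>Analytic convergence for bounded parts\<close>

lemma one_minus_power_Suc_nonzero:
  fixes q :: "'a::real_normed_field"
  assumes "norm q < 1"
  shows "1 - q ^ Suc k \<noteq> 0"
proof
  assume "1 - q ^ Suc k = 0"
  then have "norm q ^ Suc k = 1"
    by (metis eq_iff_diff_eq_0 norm_one norm_power)
  moreover have "norm q ^ Suc k \<le> norm q"
    using assms by (intro power_Suc_le_self) auto
  ultimately show False using assms by simp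
qed

text \<open>Absolute summability of \<open>q ^ Suc k\<close> makes the product converge. No factor
  vanishes, so the limit is nonzero and reciprocals can pass to the limit.\<close>

lemma qpoch_self_LIMSEQ:
  fixes q :: complex
  assumes "norm q < 1"
  shows "qpoch q q \<longlonglongrightarrow> qpoch_inf q q" and "qpoch_inf q q \<noteq> 0"
proof -
  let ?f = "\<lambda>k. 1 - q ^ Suc k"
  have "summable (\<lambda>k. norm q * norm q ^ k)"
    using assms by (intro summable_mult summable_geometric) auto
  then have "summable (\<lambda>k. norm (- (q ^ Suc k)))"
    by (simp add: norm_mult norm_power)
  then have "convergent_prod (\<lambda>k. 1 + - (q ^ Suc k))"
    using one_minus_power_Suc_nonzero[OF assms]
    by (intro summable_imp_convergent_prod_complex) (auto simp del: power_Suc)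
  then have conv: "convergent_prod ?f" by simp
  \<comment> \<open>The partial products of \<open>prodinf\<close> include index \<open>n\<close>,
    so they have \<open>Suc n\<close> factors.\<close>
  have "(\<lambda>n. qpoch q q (Suc n)) \<longlonglongrightarrow> prodinf ?f"
    using convergent_prod_LIMSEQ[OF conv] by (simp add: qpoch_def lessThan_Suc_atMost)
  then have "qpoch q q \<longlonglongrightarrow> prodinf ?f"
    by (simp only: filterlim_sequentially_Suc)
  moreover from this have "qpoch_inf q q = prodinf ?f"
    unfolding qpoch_inf_def by (rule limI)
  ultimately show "qpoch q q \<longlonglongrightarrow> qpoch_inf q q" "qpoch_inf q q \<noteq> 0"
    using prodinf_nonzero[OF conv] one_minus_power_Suc_nonzero[OF assms] by auto
qed

text \<open>Finite partial sums are used because this bound is what later establishes convergence of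
  the series.\<close>

lemma sum_parts_le_bound:
  fixes r :: real
  assumes r: "0 \<le> r" "r < 1"
  shows "(\<Sum>n<N. of_nat (card (parts_le k n)) * r ^ n) \<le> 1 / qpoch r r k"
proof (induction k)
  case 0
  have "(\<Sum>n<N. of_nat (card (parts_le 0 n)) * r ^ n) = (\<Sum>n\<in>{..<N} \<inter> {0}. 1)"
    by (intro sum.mono_neutral_cong_right) (auto simp: parts_le_0)
  then show ?case by (cases "N = 0") auto
next
  case (Suc k)
  let ?a = "\<lambda>k n. of_nat (card (parts_le k n)) * r ^ n"
  have pos: "0 < 1 - r ^ Suc k"
    using r power_Suc_less_one[of r k] by (cases "r = 0") auto
  have "(\<Sum>n<N. ?a (Suc k) n) =
      (\<Sum>n<N. ?a k n) + (\<Sum>n<N. if Suc k \<le> n then r ^ Suc k * ?a (Suc k) (n - Suc k) else 0)"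
    unfolding sum.distrib[symmetric] by (intro sum.cong refl weighted_parts_le_Suc)
  also have "(\<Sum>n<N. if Suc k \<le> n then r ^ Suc k * ?a (Suc k) (n - Suc k) else 0) =
      (\<Sum>n\<in>{Suc k..<N}. r ^ Suc k * ?a (Suc k) (n - Suc k))"
    by (intro sum.mono_neutral_cong_right) auto
  also have "\<dots> = (\<Sum>n<N - Suc k. r ^ Suc k * ?a (Suc k) n)"
    by (rule sum.reindex_bij_witness[of _ "\<lambda>n. n + Suc k" "\<lambda>n. n - Suc k"]) auto
  \<comment> \<open>Nonnegative terms allow enlarging the range back to \<open>N\<close>. The sum is
    then the one on the left, and the inequality can be solved for it.\<close>
  also have "\<dots> \<le> (\<Sum>n<N. r ^ Suc k * ?a (Suc k) n)"
    using r by (intro sum_mono2) auto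
  also have "\<dots> = r ^ Suc k * (\<Sum>n<N. ?a (Suc k) n)"
    by (rule sum_distrib_left[symmetric])
  finally have "(\<Sum>n<N. ?a (Suc k) n) * (1 - r ^ Suc k) \<le> (\<Sum>n<N. ?a k n)"
    by (simp add: algebra_simps del: power_Suc)
  also have "\<dots> \<le> 1 / qpoch r r k" by (rule Suc)
  finally show ?case
    using pos
    by (simp add: qpoch_self_Suc pos_le_divide_eq del: power_Suc flip: divide_divide_eq_left)
qed

lemma parts_le_sums:
  fixes q :: complex
  assumes q: "norm q < 1"
  shows "(\<lambda>n. of_nat (card (parts_le k n)) * q ^ n) sums (1 / qpoch q q k)"
proof (induction k)
  case 0
  have "(\<lambda>n. if n = 0 then 1 else 0 :: complex) sums 1"
    using sums_single[of 0 "\<lambda>_. 1 :: complex"] by simp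
  also have "(\<lambda>n. if n = 0 then 1 else 0) = (\<lambda>n. of_nat (card (parts_le 0 n)) * q ^ n)"
    by (auto simp: parts_le_0)
  finally show ?case by simp
next
  case (Suc k)
  let ?a = "\<lambda>k n. of_nat (card (parts_le k n)) * q ^ n"
  \<comment> \<open>The bound at \<open>norm q\<close> gives absolute convergence, so that
    \<open>S\<close> exists before the recursion is solved for it.\<close>
  have "summable (\<lambda>n. norm (?a (Suc k) n))"
    using sum_parts_le_bound[of "norm q" "Suc k"] q
    by (intro summableI_nonneg_bounded[of _ "1 / qpoch (norm q) (norm q) (Suc k)"])
       (auto simp: norm_mult norm_power)
  then have "summable (?a (Suc k))"
    by (rule summable_norm_cancel)
  then obtain S where S: "?a (Suc k) sums S"
    by (auto simp only: summable_def)
  let ?g = "\<lambda>n. if Suc k \<le> n then q ^ Suc k * ?a (Suc k) (n - Suc k) else 0"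
  have "(\<lambda>n. ?g (n + Suc k)) sums (q ^ Suc k * S)"
    using sums_mult[OF S, of "q ^ Suc k"] by simp
  then have "?g sums (q ^ Suc k * S)"
    by (subst (asm) sums_zero_iff_shift) auto
  from sums_add[OF Suc this] have "(\<lambda>n. ?a k n + ?g n) sums (1 / qpoch q q k + q ^ Suc k * S)" .
  also have "(\<lambda>n. ?a k n + ?g n) = ?a (Suc k)"
    by (intro ext weighted_parts_le_Suc [symmetric])
  finally have "S = 1 / qpoch q q k + q ^ Suc k * S"
    using S sums_unique2 by blast
  then have "S * (1 - q ^ Suc k) = 1 / qpoch q q k"
    by (simp add: algebra_simps del: power_Suc)
  then have "S = 1 / qpoch q q (Suc k)"
    using one_minus_power_Suc_nonzero[OF q, of k]
    by (simp add: qpoch_self_Suc eq_divide_eq del: power_Suc flip: divide_divide_eq_left)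
  with S show ?case by simp
qed

section \<open>Dominated convergence to the series over all partitions\<close>

lemma card_parts_le_le: "card (parts_le k n) \<le> card {xs. partition_of n xs}"
  by (intro card_mono finite_partitions) (auto simp: parts_le_def)

lemma partitions_sums:
  fixes q :: complex
  assumes q: "norm q < 1"
  shows "(\<lambda>n. of_nat (card {xs. partition_of n xs}) * q ^ n) sums (1 / qpoch_inf q q)"
proof -
  define r where "r = norm q"
  have r: "0 \<le> r" "r < 1" using q by (auto simp: r_def)
  define p where "p n = card {xs. partition_of n xs}" for n
  \<comment> \<open>A convergent sequence is bounded, which gives one \<open>B\<close> for all
    \<open>k\<close>. Embedding \<open>r\<close> in the complex numbers gives access to the limit
    proved there.\<close>
  have "(\<lambda>k. 1 / qpoch (complex_of_real r) (of_real r) k)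
      \<longlonglongrightarrow> 1 / qpoch_inf (of_real r) (of_real r)"
    using qpoch_self_LIMSEQ[of "of_real r"] r by (intro tendsto_intros) auto
  then have "Bseq (\<lambda>k. 1 / qpoch (complex_of_real r) (of_real r) k)"
    by (intro convergent_imp_Bseq convergentI)
  then obtain B where B: "norm (1 / qpoch (complex_of_real r) (of_real r) k) \<le> B" for k
    by (auto simp: Bseq_def)
  have of_real_qpoch: "qpoch (complex_of_real r) (of_real r) k = of_real (qpoch r r k)" for k
    by (simp add: qpoch_def)
  have sum_le: "(\<Sum>n<N. of_nat (p n) * r ^ n) \<le> B" for N
  proof -
    \<comment> \<open>With \<open>k = N\<close> the restriction on parts is vacuous for every
      \<open>n < N\<close>.\<close>
    have "(\<Sum>n<N. of_nat (p n) * r ^ n) = (\<Sum>n<N. of_nat (card (parts_le N n)) * r ^ n)"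
      by (simp add: p_def parts_le_eq_partitions)
    also have "\<dots> \<le> 1 / qpoch r r N"
      by (rule sum_parts_le_bound[OF r])
    also have "\<dots> \<le> B"
      using B[of N] abs_ge_self[of "1 / qpoch r r N"] unfolding of_real_qpoch
      by (simp add: norm_divide)
    finally show ?thesis .
  qed
  have summ: "summable (\<lambda>n. of_nat (p n) * r ^ n)"
    using r sum_le by (intro summableI_nonneg_bounded[of _ B]) auto
  let ?a = "\<lambda>n k. of_nat (card (parts_le k n)) * q ^ n" and ?b = "\<lambda>n. of_nat (p n) * q ^ n"
  have "(\<lambda>k. ?a n k) \<longlonglongrightarrow> ?b n" for n
    by (rule tendsto_eventually, rule eventually_mono[OF eventually_ge_at_top[of n]])
       (simp add: p_def parts_le_eq_partitions)
  \<comment> \<open>This majorant is independent of \<open>k\<close> and summable by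
    \<open>summ\<close>, so Tannery's theorem exchanges the limit in \<open>k\<close> with the sum
    over \<open>n\<close>.\<close>
  moreover have "norm (?a n k) \<le> of_nat (p n) * r ^ n" for n k
    using card_parts_le_le[of k n] r
    by (auto simp: norm_mult norm_power r_def p_def intro!: mult_right_mono)
  then have "\<forall>\<^sub>F (n, k) in sequentially \<times>\<^sub>F sequentially. norm (?a n k) \<le> of_nat (p n) * r ^ n"
    by (simp add: case_prod_unfold)
  ultimately have tannery: "summable (\<lambda>n. norm (?b n)) \<and> (\<lambda>k. \<Sum>n. ?a n k) \<longlonglongrightarrow> suminf ?b"
    using tannerys_theorem[of ?a ?b sequentially "\<lambda>n. of_nat (p n) * r ^ n"] summ by simp
  have "(\<lambda>k. 1 / qpoch q q k) \<longlonglongrightarrow> suminf ?b"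
    using tannery parts_le_sums[OF q] by (simp add: sums_iff)
  moreover have "(\<lambda>k. 1 / qpoch q q k) \<longlonglongrightarrow> 1 / qpoch_inf q q"
    using qpoch_self_LIMSEQ[OF q] by (intro tendsto_intros)
  ultimately have "suminf ?b = 1 / qpoch_inf q q"
    by (rule LIMSEQ_unique)
  with tannery show ?thesis
    by (auto simp: sums_iff p_def dest: summable_norm_cancel)
qed

theorem theorem1:
  shows "(Abs_fps (\<lambda>n. of_nat (rho n)) :: rat fps)
           = 1 / qpoch_inf (fps_X ^ 2) (fps_X ^ 2) - 1 / (1 - fps_X ^ 2)
         \<and> (\<forall>q :: complex. norm q < 1 \<longrightarrow>
             (\<lambda>n. of_nat (rho n) * q ^ n) sums
               (1 / qpoch_inf (q ^ 2) (q ^ 2) - 1 / (1 - q ^ 2)))"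
proof (intro conjI allI impI)
  let ?E = "Abs_fps (\<lambda>n. if even n then 1 else 0) :: rat fps"
  \<comment> \<open>Subtracting the copy of \<open>?E\<close> shifted by two places leaves only the
    constant term.\<close>
  have "(1 - fps_X ^ 2) * ?E = 1"
    by (rule fps_ext) (auto simp: left_diff_distrib fps_X_power_mult_nth)
  then have "?E = inverse (1 - fps_X ^ 2)"
    by (rule fps_inverse_unique [symmetric])
  then have "1 / (1 - fps_X ^ 2) = ?E"
    by (simp add: fps_divide_unit)
  then show "(Abs_fps (\<lambda>n. of_nat (rho n)) :: rat fps)
           = 1 / qpoch_inf (fps_X ^ 2) (fps_X ^ 2) - 1 / (1 - fps_X ^ 2)"
    using card_partitions_pos
    by (auto simp: fps_eq_iff fps_partitions rho_odd rho_even of_nat_diff Suc_le_eq elim!: evenE)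
next
  fix q :: complex
  assume "norm q < 1"
  then have q2: "norm (q ^ 2) < 1"
    by (simp add: norm_power power_less_one_iff)
  have "(\<lambda>m. of_nat (rho (2 * m)) * q ^ (2 * m)) =
      (\<lambda>m. of_nat (card {xs. partition_of m xs}) * (q ^ 2) ^ m - (q ^ 2) ^ m)"
    using card_partitions_pos
    by (auto simp: rho_even of_nat_diff Suc_le_eq power_mult left_diff_distrib)
  then have "(\<lambda>m. of_nat (rho (2 * m)) * q ^ (2 * m)) sums
      (1 / qpoch_inf (q ^ 2) (q ^ 2) - 1 / (1 - q ^ 2))"
    using sums_diff[OF partitions_sums[OF q2] geometric_sums[OF q2]] by simp
  \<comment> \<open>Since the odd terms vanish, reindexing along the doubling map turns the sum over
    \<open>m\<close> into the sum over all \<open>n\<close>.\<close>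
  moreover have "rho n = 0" if "n \<notin> range ((*) 2)" for n
    using that by (intro rho_odd) (auto elim: evenE)
  ultimately show "(\<lambda>n. of_nat (rho n) * q ^ n) sums (1 / qpoch_inf (q ^ 2) (q ^ 2) - 1 / (1 - q ^ 2))"
    by (subst (asm) sums_mono_reindex) (auto simp: strict_mono_def)
qed

end
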